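(* Let $X\subset\mathbb{R}^m$ be a subset and let $x_0\in X$. Suppose that $X$ has a unique tangent cone $T_{x_0}X$ at $x_0$. If $X$ is Lipschitz normally embedded, then $T_{x_0}X$ is Lipschitz normally embedded.
   Context: All subsets of Euclidean space carry the induced Euclidean metric. Inner distance: for a path connected subset $X\subset\mathbb{R}^m$ and $x_1,x_2\in X$, $d_X(x_1,x_2)$ is the infimum of the lengths of paths on $X$ connecting $x_1$ to $x_2$. A (path connected) subset $X\subset\mathbb{R}^m$ is Lipschitz normally embedded if there exists a constant $\lambda\ge 1$ such that $d_X(x_1,x_2)\le\lambda\|x_1-x_2\|$ for all $x_1,x_2\in X$. Tangent cones: let $X\subset\mathbb{R}^m$ and $p\in\overline{X}$. Given a sequence $S=\{t_j\}_{j\in\mathbb{N}}$ of positive real numbers with $\lim_{j\to\infty}t_j=0$, a vector $v\in\mathbb{R}^m$ is a direction of $X$ at $p$ (with respect to $S$) if there exist a sequence $\{x_j\}_{j\in\mathbb{N}}\subset X\setminus\{p\}$ and $j_0\in\mathbb{N}$ such that $\|x_j-p\|=t_j$ for all $j\ge j_0$ and $\lim_{j\to\infty}\frac{x_j-p}{t_j}=v$. The set of all such directions is denoted $D_p^S(X)$. A set $Z\subset\mathbb{R}^m$ is a tangent cone of $X$ at $p$ if there is a sequence $S=\{t_j\}_{j\in\mathbb{N}}$ of positive real numbers with $t_j\to 0$ such that $Z=\{tv : v\in D_p^S(X),\ t\ge 0\}$. When $X$ has a unique tangent cone at $p$ (i.e. this set is the same for all such $S$), it is denoted $T_pX$. 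*)

theory Defs
  imports "HOL-Analysis.Analysis"
begin

definition path_length :: "(real \<Rightarrow> 'a::metric_space) \<Rightarrow> ennreal" where
  "path_length g =
     (SUP (n, t) \<in> {(n::nat, t::nat \<Rightarrow> real). t 0 = 0 \<and> t n = 1 \<and> (\<forall>i<n. t i \<le> t (Suc i))}.
        \<Sum>i<n. ennreal (dist (g (t i)) (g (t (Suc i)))))"

(* The value is \<infinity> if x and y are joined by no path in X of finite length. *)
definition inner_dist :: "'a::metric_space set \<Rightarrow> 'a \<Rightarrow> 'a \<Rightarrow> ennreal" where
  "inner_dist X x y =
     (INF g \<in> {g. path g \<and> path_image g \<subseteq> X \<and> pathstart g = x \<and> pathfinish g = y}. path_length g)"

(* The library's path_connected, and hence this predicate, holds for the empty set. *)
definition lipschitz_normally_embedded :: "'a::real_normed_vector set \<Rightarrow> bool" where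
  "lipschitz_normally_embedded X \<longleftrightarrow>
     path_connected X \<and>
     (\<exists>l::real. l \<ge> 1 \<and> (\<forall>x1\<in>X. \<forall>x2\<in>X. inner_dist X x1 x2 \<le> ennreal (l * norm (x1 - x2))))"

definition directions :: "'a::real_normed_vector set \<Rightarrow> 'a \<Rightarrow> (nat \<Rightarrow> real) \<Rightarrow> 'a set" where
  "directions X p S =
     {v. \<exists>(x::nat \<Rightarrow> 'a) j0. range x \<subseteq> X - {p} \<and> (\<forall>j\<ge>j0. norm (x j - p) = S j) \<and>
           (\<lambda>j. (x j - p) /\<^sub>R S j) \<longlonglongrightarrow> v}"

(* If p is an isolated point of X, there are no directions and the cone is the empty set. *)
definition is_tangent_cone :: "'a::real_normed_vector set \<Rightarrow> 'a \<Rightarrow> 'a set \<Rightarrow> bool" where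
  "is_tangent_cone X p Z \<longleftrightarrow>
     (\<exists>S::nat \<Rightarrow> real. (\<forall>j. S j > 0) \<and> S \<longlonglongrightarrow> 0 \<and> Z = {t *\<^sub>R v | t v. v \<in> directions X p S \<and> t \<ge> 0})"

definition has_unique_tangent_cone :: "'a::real_normed_vector set \<Rightarrow> 'a \<Rightarrow> bool" where
  "has_unique_tangent_cone X p \<longleftrightarrow> (\<exists>!Z. is_tangent_cone X p Z)"

(* Meaningful only if has_unique_tangent_cone X p holds. *)
definition tangent_cone :: "'a::real_normed_vector set \<Rightarrow> 'a \<Rightarrow> 'a set" where
  "tangent_cone X p = (THE Z. is_tangent_cone X p Z)"

end

theory Submission
  imports Defs "HOL-Complex_Analysis.Great_Picard"
begin

text \<open>
  Fix two points \<open>v\<close>, \<open>w\<close> of the tangent cone \<open>T\<close> and one null sequence of scales \<open>S\<close>.  Uniqueness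
  of the cone says that the cone can be computed along any sequence of scales.  It is used twice.
  It makes \<open>v\<close> and \<open>w\<close> limits of blow-ups \<open>(x\<^sub>j - p) / S\<^sub>j\<close> and \<open>(y\<^sub>j - p) / S\<^sub>j\<close> of points of
  \<open>X\<close> along the same \<open>S\<close> (\<open>tangent_cone_approximable\<close>), and conversely it puts into \<open>T\<close> every limit
  of blow-ups of points of \<open>X\<close>, whatever their distances to \<open>p\<close> (\<open>blowup_limit_in_tangent_cone\<close>).

  If \<open>X\<close> is Lipschitz normally embedded with constant \<open>l\<close>, then \<open>x\<^sub>j\<close> and \<open>y\<^sub>j\<close> are joined in \<open>X\<close>
  by a path of length at most \<open>l * norm (x\<^sub>j - y\<^sub>j) + S\<^sub>j / (j + 1)\<close>.  Parametrised proportionally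
  to arc length (\<open>lipschitz_reparametrization\<close>) and blown up by \<open>1 / S\<^sub>j\<close>, these paths have Lipschitz
  constants tending to \<open>l * norm (v - w)\<close>.  By the Arzela--Ascoli theorem a subsequence converges
  uniformly.  The limit joins \<open>v\<close> to \<open>w\<close>, stays in \<open>T\<close>, and is Lipschitz with constant
  \<open>l * norm (v - w)\<close>, so that its length is at most this number.  Thus \<open>T\<close> is Lipschitz normally
  embedded with the same constant \<open>l\<close>.
\<close>

section \<open>Length and Lipschitz parametrisations\<close>

lemma path_length_le_lipschitz:
  fixes g :: "real \<Rightarrow> 'a::metric_space"
  assumes "C-lipschitz_on {0..1} g"
  shows "path_length g \<le> ennreal C"
  unfolding path_length_def
proof (rule SUP_least, clarify)
  fix n :: nat and t :: "nat \<Rightarrow> real"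
  assume t: "t 0 = 0" "t n = 1" "\<forall>i<n. t i \<le> t (Suc i)"
  have mono: "t i \<le> t j" if "i \<le> j" "j \<le> n" for i j
    using that
  proof (induction j rule: dec_induct)
    case (step j)
    then show ?case using t(3) by (meson Suc_le_lessD less_imp_le order_trans)
  qed simp
  have range: "t i \<in> {0..1}" if "i \<le> n" for i
    using mono[of 0 i] mono[of i n] that t by auto
  have "(\<Sum>i<n. dist (g (t i)) (g (t (Suc i)))) \<le> (\<Sum>i<n. C * (t (Suc i) - t i))"
  proof (rule sum_mono)
    fix i assume "i \<in> {..<n}"
    then have "i < n" by simp
    then have "dist (g (t i)) (g (t (Suc i))) \<le> C * dist (t i) (t (Suc i))"
      by (intro lipschitz_onD[OF assms] range) auto
    then show "dist (g (t i)) (g (t (Suc i))) \<le> C * (t (Suc i) - t i)"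
      using t(3) \<open>i < n\<close> by (simp add: dist_real_def)
  qed
  also have "\<dots> = C"
    using t by (simp add: sum_distrib_left[symmetric] sum_lessThan_telescope)
  finally have "ennreal (\<Sum>i<n. dist (g (t i)) (g (t (Suc i)))) \<le> ennreal C"
    by (rule ennreal_leI)
  then show "(\<Sum>i<n. ennreal (dist (g (t i)) (g (t (Suc i))))) \<le> ennreal C"
    by (simp add: sum_ennreal)
qed

text \<open>
  The length \<open>len s\<close> of the part of the curve before parameter \<open>s\<close> serves as a new parameter.  Only
  the inequality \<open>dist (g a) (g b) \<le> len b - len a\<close> is recorded: it follows by appending one point to
  a partition of \<open>{0..a}\<close>, and it is all that the reparametrisation requires of arc length.
\<close>

lemma rectifiable_length_function:
  fixes g :: "real \<Rightarrow> 'a::metric_space"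
  assumes "path_length g \<le> ennreal L" "L \<ge> 0"
  obtains len :: "real \<Rightarrow> real"
  where "len 0 \<ge> 0" "len 1 \<le> L"
    "\<And>a b. 0 \<le> a \<Longrightarrow> a \<le> b \<Longrightarrow> b \<le> 1 \<Longrightarrow> dist (g a) (g b) \<le> len b - len a"
proof -
  define P where "P s = {(n::nat, t::nat \<Rightarrow> real). t 0 = 0 \<and> t n = s \<and> (\<forall>i<n. t i \<le> t (Suc i))}" for s
  define vsum where "vsum = (\<lambda>(n::nat, t::nat \<Rightarrow> real). \<Sum>i<n. dist (g (t i)) (g (t (Suc i))))"
  define len where "len s = (SUP q\<in>P s. vsum q)" for s
  have append: "\<exists>q'\<in>P b. vsum q' = vsum q + dist (g a) (g b)" if "q \<in> P a" "a \<le> b" for a b q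
  proof -
    obtain n t where q: "q = (n, t)" by force
    have t: "t 0 = 0" "t n = a" "\<forall>i<n. t i \<le> t (Suc i)"
      using that q by (auto simp: P_def)
    define t' where "t' = t(Suc n := b)"
    have "(Suc n, t') \<in> P b"
      using t that(2) by (auto simp: P_def t'_def less_Suc_eq)
    moreover have "(\<Sum>i<n. dist (g (t' i)) (g (t' (Suc i)))) = (\<Sum>i<n. dist (g (t i)) (g (t (Suc i))))"
      by (intro sum.cong) (auto simp: t'_def)
    then have "vsum (Suc n, t') = vsum q + dist (g a) (g b)"
      using t by (simp add: vsum_def q) (simp add: t'_def)
    ultimately show ?thesis by blast
  qed
  have total: "vsum q \<le> L" if "q \<in> P 1" for q
  proof -
    obtain n t where q: "q = (n, t)" by force
    have "ennreal (vsum q) = (\<Sum>i<n. ennreal (dist (g (t i)) (g (t (Suc i)))))"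
      by (simp add: vsum_def q sum_ennreal)
    also have "\<dots> \<le> path_length g"
      unfolding path_length_def using that q
      by (intro SUP_upper2[of "(n, t)"]) (auto simp: P_def)
    also have "\<dots> \<le> ennreal L" by fact
    finally show ?thesis using assms(2) by (simp add: ennreal_le_iff)
  qed
  have bound: "vsum q \<le> L" if q: "q \<in> P s" "s \<le> 1" for q s
  proof -
    obtain q' where "q' \<in> P 1" "vsum q' = vsum q + dist (g s) (g 1)"
      using append[OF q] by blast
    then show ?thesis using total[of q'] zero_le_dist[of "g s" "g 1"] by linarith
  qed
  have bdd: "bdd_above (vsum ` P s)" if "s \<le> 1" for s
    by (rule bdd_aboveI2[OF bound[OF _ that]])
  have triv: "(0, \<lambda>_. 0) \<in> P 0" by (simp add: P_def)
  have nonempty: "P s \<noteq> {}" if "0 \<le> s" for s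
    using append[OF triv that] by blast
  show thesis
  proof
    have "vsum (0, \<lambda>_. 0) \<le> len 0"
      unfolding len_def by (rule cSUP_upper[OF triv bdd]) simp
    then show "len 0 \<ge> 0" by (simp add: vsum_def)
    show "len 1 \<le> L"
      unfolding len_def by (rule cSUP_least) (use nonempty[of 1] total in auto)
    fix a b :: real assume ab: "0 \<le> a" "a \<le> b" "b \<le> 1"
    have "len a \<le> len b - dist (g a) (g b)"
      unfolding len_def[of a]
    proof (rule cSUP_least[OF nonempty[OF ab(1)]])
      fix q assume "q \<in> P a"
      then obtain q' where q': "q' \<in> P b" "vsum q' = vsum q + dist (g a) (g b)"
        using append ab(2) by blast
      have "vsum q' \<le> len b"
        unfolding len_def by (rule cSUP_upper[OF q'(1) bdd[OF ab(3)]])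
      then show "vsum q \<le> len b - dist (g a) (g b)" using q'(2) by simp
    qed
    then show "dist (g a) (g b) \<le> len b - len a" by simp
  qed
qed

text \<open>
  With \<open>h u = Sup {s. len s \<le> u}\<close> as generalised inverse of the length function, \<open>g \<circ> h\<close> is
  1-Lipschitz: strictly between \<open>h u\<close> and \<open>h u'\<close> the values of \<open>len\<close> lie between \<open>u\<close> and \<open>u'\<close>, and
  continuity of \<open>g\<close> carries the resulting bound to the end points.
\<close>

lemma lipschitz_reparametrization:
  fixes g :: "real \<Rightarrow> 'a::metric_space"
  assumes g: "path g" and length: "path_length g \<le> ennreal L" and L: "L \<ge> 0"
  obtains c :: "real \<Rightarrow> 'a" where "L-lipschitz_on {0..1} c" "c ` {0..1} \<subseteq> path_image g"
    "c 0 = pathstart g" "c 1 = pathfinish g"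
proof -
  obtain len :: "real \<Rightarrow> real" where len0: "len 0 \<ge> 0" and len1: "len 1 \<le> L"
    and len: "\<And>a b. 0 \<le> a \<Longrightarrow> a \<le> b \<Longrightarrow> b \<le> 1 \<Longrightarrow> dist (g a) (g b) \<le> len b - len a"
    using rectifiable_length_function[OF length L] by blast
  have cont: "continuous_on {0..1} g" using g by (simp add: path_def)
  \<comment> \<open>The point \<open>0\<close> is inserted because \<open>len 0\<close> is only known to be nonnegative.\<close>
  define A where "A u = insert 0 {s\<in>{0..1}. len s \<le> u}" for u
  define h where "h u = Sup (A u)" for u
  have A01: "A u \<subseteq> {0..1}" for u by (auto simp: A_def)
  have bddA: "bdd_above (A u)" for u using A01 by (meson bdd_above_Icc bdd_above_mono)
  have zeroA: "0 \<in> A u" for u by (simp add: A_def)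
  have upper: "s \<le> h u" if "s \<in> A u" for s u
    unfolding h_def by (rule cSup_upper[OF that bddA])
  have "h u \<le> 1" for u
    unfolding h_def by (rule cSup_least) (use zeroA A01 in fastforce)+
  then have h01: "h u \<in> {0..1}" for u using upper[OF zeroA] by simp
  have hmono: "h u \<le> h u'" if "u \<le> u'" for u u'
    unfolding h_def by (rule cSup_subset_mono) (use that in \<open>auto simp: A_def bddA[unfolded A_def]\<close>)
  have above: "u < len a" if "h u < a" "a \<le> 1" for u a
  proof (rule ccontr)
    assume "\<not> u < len a"
    then have "a \<in> A u" using that h01[of u] by (auto simp: A_def)
    then show False using upper that(1) by fastforce
  qed
  have below: "len b \<le> u" if b: "0 < b" "b < h u" for u b
  proof -
    obtain s where s: "s \<in> A u" "b < s"
      using b(2) less_cSup_iff[OF _ bddA] zeroA unfolding h_def by blast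
    then have "s \<in> {0..1}" "len s \<le> u" using that by (auto simp: A_def)
    moreover have "0 \<le> len s - len b"
      using b(1) s(2) \<open>s \<in> {0..1}\<close> by (intro order_trans[OF zero_le_dist len]) auto
    ultimately show ?thesis by simp
  qed
  have ends: "dist (g a) (g b) \<le> M"
    if "0 \<le> a" "a < b" "b \<le> 1"
      and *: "\<And>a' b'. a < a' \<Longrightarrow> a' < b' \<Longrightarrow> b' < b \<Longrightarrow> dist (g a') (g b') \<le> M" for a b M
  proof -
    \<comment> \<open>The denominator is at least \<open>3\<close>, so that \<open>a + \<delta> n < b - \<delta> n\<close> for every \<open>n\<close>.\<close>
    define \<delta> where "\<delta> n = (b - a) / (real n + 3)" for n :: nat
    have \<delta>: "0 < \<delta> n" "\<delta> n * 3 \<le> b - a" for n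
      using that(2) mult_right_mono[of a b "real n"] by (auto simp: \<delta>_def field_simps)
    have lim: "\<delta> \<longlonglongrightarrow> 0" unfolding \<delta>_def by real_asymp
    have "(\<lambda>n. a + \<delta> n) \<longlonglongrightarrow> a + 0" "(\<lambda>n. b - \<delta> n) \<longlonglongrightarrow> b - 0"
      by (intro tendsto_intros lim)+
    moreover have "a + \<delta> n \<in> {0..1}" "b - \<delta> n \<in> {0..1}" for n
      using \<delta>[of n] that(1-3) unfolding atLeastAtMost_iff by linarith+
    ultimately have "(\<lambda>n. g (a + \<delta> n)) \<longlonglongrightarrow> g a" "(\<lambda>n. g (b - \<delta> n)) \<longlonglongrightarrow> g b"
      using that(1-3) by (auto intro!: continuous_on_tendsto_compose[OF cont] always_eventually)
    then have "(\<lambda>n. dist (g (a + \<delta> n)) (g (b - \<delta> n))) \<longlonglongrightarrow> dist (g a) (g b)"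
      by (rule tendsto_dist)
    moreover have "dist (g (a + \<delta> n)) (g (b - \<delta> n)) \<le> M" for n
      using \<delta>[of n] by (intro *) linarith+
    ultimately show ?thesis by (intro LIMSEQ_le_const2) auto
  qed
  have lip: "dist (g (h u)) (g (h u')) \<le> u' - u" if "u \<le> u'" for u u'
  proof (cases "h u = h u'")
    case False
    then have lt: "h u < h u'" using hmono[OF that] by simp
    show ?thesis
    proof (rule ends)
      fix a b assume ab: "h u < a" "a < b" "b < h u'"
      have "0 < a" "b \<le> 1" using ab h01[of u] h01[of u'] by auto
      then have "dist (g a) (g b) \<le> len b - len a" "u < len a" "len b \<le> u'"
        using ab by (auto intro!: len above below)
      then show "dist (g a) (g b) \<le> u' - u" by linarith
    qed (use h01[of u] h01[of u'] lt in auto)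
  qed (use that in auto)
  have h_start: "g (h 0) = g 0"
  proof (cases "h 0 = 0")
    case False
    then have "0 < h 0" using h01[of 0] by auto
    have "dist (g 0) (g (h 0)) \<le> 0"
    proof (rule ends)
      fix a b assume ab: "0 < a" "a < b" "b < h 0"
      then have "b \<le> 1" using h01[of 0] by auto
      have "dist (g a) (g b) \<le> len b - len a" "dist (g 0) (g a) \<le> len a - len 0"
        using ab \<open>b \<le> 1\<close> by (auto intro!: len)
      moreover have "len b \<le> 0" using ab by (auto intro!: below)
      ultimately show "dist (g a) (g b) \<le> 0"
        using len0 zero_le_dist[of "g 0" "g a"] by linarith
    qed (use h01[of 0] \<open>0 < h 0\<close> in auto)
    then show ?thesis by simp
  qed simp
  have h_end: "h L = 1"
    using upper[of 1 L] len1 h01[of L] by (simp add: A_def)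
  show thesis
  proof
    show "L-lipschitz_on {0..1} (\<lambda>u. g (h (L * u)))"
    proof (rule lipschitz_onI)
      fix u u' :: real
      show "dist (g (h (L * u))) (g (h (L * u'))) \<le> L * dist u u'"
      proof (cases "u \<le> u'")
        case True
        then have "dist (g (h (L * u))) (g (h (L * u'))) \<le> L * u' - L * u"
          by (intro lip mult_left_mono L)
        then show ?thesis using True by (simp add: dist_real_def algebra_simps)
      next
        case False
        then have "dist (g (h (L * u'))) (g (h (L * u))) \<le> L * u - L * u'"
          by (intro lip mult_left_mono L) auto
        then show ?thesis using False by (simp add: dist_real_def dist_commute algebra_simps)
      qed
    qed (rule L)
    show "(\<lambda>u. g (h (L * u))) ` {0..1} \<subseteq> path_image g"
      using h01 by (auto simp: path_image_def)
  qed (use h_start h_end in \<open>auto simp: pathstart_def pathfinish_def\<close>)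
qed

section \<open>Unique tangent cones and blow-ups\<close>

lemma tangent_cone_eq:
  assumes "has_unique_tangent_cone X p" "\<And>j. S j > 0" "S \<longlonglongrightarrow> 0"
  shows "tangent_cone X p = {t *\<^sub>R v | t v. v \<in> directions X p S \<and> t \<ge> 0}"
  unfolding tangent_cone_def
  by (rule the1_equality) (use assms in \<open>auto simp: has_unique_tangent_cone_def is_tangent_cone_def\<close>)

lemma zero_in_tangent_cone:
  assumes "has_unique_tangent_cone X p" "v \<in> tangent_cone X p"
  shows "0 \<in> tangent_cone X p"
proof -
  have *: "\<And>j. 1 / real (Suc j) > 0" "(\<lambda>j. 1 / real (Suc j)) \<longlonglongrightarrow> 0"
    by (simp, real_asymp)
  show ?thesis
    using assms(2) unfolding tangent_cone_eq[OF assms(1) *] by force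
qed

lemma norm_direction:
  assumes "v \<in> directions X p S" "\<And>j. S j > 0"
  shows "norm v = 1"
proof -
  obtain x j0 where x: "\<forall>j\<ge>j0. norm (x j - p) = S j" "(\<lambda>j. (x j - p) /\<^sub>R S j) \<longlonglongrightarrow> v"
    using assms(1) unfolding directions_def by blast
  have "norm ((x j - p) /\<^sub>R S j) = 1" if "j \<ge> j0" for j
    using x(1) that assms(2)[of j] by simp
  then have "(\<lambda>j. norm ((x j - p) /\<^sub>R S j)) \<longlonglongrightarrow> 1"
    by (intro tendsto_eventually) (auto simp: eventually_sequentially)
  then show ?thesis using tendsto_norm[OF x(2)] LIMSEQ_unique by blast
qed

text \<open>
  Directions are unit vectors, so a nonzero \<open>v\<close> in the cone computed along the scales
  \<open>norm v * S j\<close> is \<open>norm v\<close> times a direction along these scales, and the points that define this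
  direction, blown up by \<open>S j\<close> alone, converge to \<open>v\<close>.
\<close>

lemma tangent_cone_approximable:
  assumes unique: "has_unique_tangent_cone X p" and "p \<in> X" and v: "v \<in> tangent_cone X p"
    and S: "\<And>j. S j > 0" "S \<longlonglongrightarrow> 0"
  obtains x where "\<And>j. x j \<in> X" "(\<lambda>j. (x j - p) /\<^sub>R S j) \<longlonglongrightarrow> v"
proof (cases "v = 0")
  case True
  show thesis by (rule that[of "\<lambda>_. p"]) (use True \<open>p \<in> X\<close> in auto)
next
  case False
  define S' where "S' j = norm v * S j" for j
  have S': "\<And>j. S' j > 0" "S' \<longlonglongrightarrow> 0"
    unfolding S'_def using S(1) False tendsto_mult_right_zero[OF S(2)] by simp_all
  obtain t u where tu: "v = t *\<^sub>R u" "u \<in> directions X p S'" "t \<ge> 0"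
    using v unfolding tangent_cone_eq[OF unique S'] by blast
  have "norm (t *\<^sub>R u) = t" using tu(3) norm_direction[OF tu(2) S'(1)] by simp
  then have v_eq: "norm v *\<^sub>R u = v" by (simp add: tu(1))
  obtain x where x: "range x \<subseteq> X - {p}" "(\<lambda>j. (x j - p) /\<^sub>R S' j) \<longlonglongrightarrow> u"
    using tu(2) unfolding directions_def by blast
  show thesis
  proof
    show "x j \<in> X" for j using x(1) by auto
    have "(\<lambda>j. norm v *\<^sub>R ((x j - p) /\<^sub>R S' j)) \<longlonglongrightarrow> norm v *\<^sub>R u"
      by (intro tendsto_intros x(2))
    moreover have "norm v *\<^sub>R ((x j - p) /\<^sub>R S' j) = (x j - p) /\<^sub>R S j" for j
      using False by (simp add: S'_def)
    ultimately show "(\<lambda>j. (x j - p) /\<^sub>R S j) \<longlonglongrightarrow> v"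
      by (simp only: v_eq)
  qed
qed

text \<open>
  The scales of the approximating points themselves, \<open>norm (x j - p)\<close>, form an admissible
  sequence once the first terms are dropped, and along it the points realise the direction
  \<open>v /\<^sub>R norm v\<close>; uniqueness puts this direction into the cone.  The vector \<open>0\<close> has to be treated
  apart: at an isolated point of \<open>X\<close> it is a limit of blow-ups, but the cone is empty.
\<close>

lemma blowup_limit_in_tangent_cone:
  assumes unique: "has_unique_tangent_cone X p" and zero: "0 \<in> tangent_cone X p"
    and x: "\<And>j. x j \<in> X" and S: "\<And>j. S j > 0" "S \<longlonglongrightarrow> 0"
    and lim: "(\<lambda>j. (x j - p) /\<^sub>R S j) \<longlonglongrightarrow> v"
  shows "v \<in> tangent_cone X p"
proof (cases "v = 0")
  case False
  have "\<forall>\<^sub>F j in sequentially. (x j - p) /\<^sub>R S j \<noteq> 0"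
    using lim False by (rule tendsto_imp_eventually_ne)
  then obtain N where N: "\<And>j. j \<ge> N \<Longrightarrow> x j \<noteq> p"
    by (auto simp: eventually_sequentially)
  define y where "y j = x (j + N)" for j
  define R where "R j = norm (y j - p)" for j
  have y: "y j \<in> X - {p}" for j using x N by (simp add: y_def)
  have lim': "(\<lambda>j. (y j - p) /\<^sub>R S (j + N)) \<longlonglongrightarrow> v"
    unfolding y_def by (rule LIMSEQ_ignore_initial_segment[OF lim])
  have S': "(\<lambda>j. S (j + N)) \<longlonglongrightarrow> 0"
    by (rule LIMSEQ_ignore_initial_segment[OF S(2)])
  have R_eq: "R j = S (j + N) * norm ((y j - p) /\<^sub>R S (j + N))" for j
    using S(1)[of "j + N"] by (simp add: R_def)
  have R: "\<And>j. R j > 0" "R \<longlonglongrightarrow> 0"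
  proof -
    show "R j > 0" for j using y[of j] by (simp add: R_def)
    have "(\<lambda>j. S (j + N) * norm ((y j - p) /\<^sub>R S (j + N))) \<longlonglongrightarrow> 0 * norm v"
      by (intro tendsto_mult S' tendsto_norm lim')
    then show "R \<longlonglongrightarrow> 0" unfolding R_eq[symmetric] by simp
  qed
  have "(\<lambda>j. ((y j - p) /\<^sub>R S (j + N)) /\<^sub>R norm ((y j - p) /\<^sub>R S (j + N))) \<longlonglongrightarrow> v /\<^sub>R norm v"
    by (intro tendsto_intros lim') (use False in auto)
  moreover have "((y j - p) /\<^sub>R S (j + N)) /\<^sub>R norm ((y j - p) /\<^sub>R S (j + N)) = (y j - p) /\<^sub>R R j" for j
    using S(1)[of "j + N"] by (simp add: R_def)
  ultimately have "(\<lambda>j. (y j - p) /\<^sub>R R j) \<longlonglongrightarrow> v /\<^sub>R norm v" by (simp only:)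
  then have "v /\<^sub>R norm v \<in> directions X p R"
    unfolding directions_def using y R_def by (intro CollectI exI[of _ y] exI[of _ 0]) auto
  moreover have "v = norm v *\<^sub>R (v /\<^sub>R norm v)" using False by simp
  ultimately show ?thesis
    unfolding tangent_cone_eq[OF unique R] using norm_ge_zero[of v] by blast
qed (use zero in simp)

section \<open>Limits of blown-up paths\<close>

text \<open>
  A limit of functions whose Lipschitz constants converge is Lipschitz with the limit constant;
  a bound on these constants gives the equicontinuity needed for compactness.
\<close>

lemma lipschitz_limit_subsequence:
  fixes F :: "nat \<Rightarrow> real \<Rightarrow> 'a::{real_normed_vector,heine_borel}"
  assumes lip: "\<And>n. (L n)-lipschitz_on {0..1} (F n)" and L: "L \<longlonglongrightarrow> C"
    and start: "(\<lambda>n. F n 0) \<longlonglongrightarrow> v"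
  obtains f k where "C-lipschitz_on {0..1} f" "strict_mono k"
    "\<And>u. u \<in> {0..1} \<Longrightarrow> (\<lambda>n. F (k n) u) \<longlonglongrightarrow> f u"
proof -
  obtain B where B: "B > 0" "\<And>n. norm (L n) \<le> B"
    using convergent_imp_Bseq[OF convergentI[OF L]] by (auto elim: BseqE)
  obtain B' where B': "\<And>n. norm (F n 0) \<le> B'"
    using convergent_imp_Bseq[OF convergentI[OF start]] unfolding Bseq_def by blast
  have FB: "norm (F n u - F n u') \<le> B * \<bar>u - u'\<bar>" if "u \<in> {0..1}" "u' \<in> {0..1}" for n u u'
  proof -
    have "norm (F n u - F n u') \<le> L n * \<bar>u - u'\<bar>"
      using lipschitz_onD[OF lip that] by (simp add: dist_norm)
    also have "\<dots> \<le> B * \<bar>u - u'\<bar>"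
      using B(2)[of n] by (intro mult_right_mono) auto
    finally show ?thesis .
  qed
  obtain f k where f: "strict_mono (k :: nat \<Rightarrow> nat)"
    "\<And>e. 0 < e \<Longrightarrow> \<exists>N. \<forall>n u. n \<ge> N \<and> u \<in> {0..1} \<longrightarrow> norm (F (k n) u - f u) < e"
  proof (rule Arzela_Ascoli[of "{0..1::real}" F "B' + B"])
    show "compact {0..1::real}" by simp
    show "norm (F n u) \<le> B' + B" if "u \<in> {0..1}" for n u
    proof -
      have "norm (F n u - F n 0) \<le> B * 1"
        by (rule order_trans[OF FB[OF that] mult_left_mono]) (use that B(1) in auto)
      then show ?thesis using B'[of n] norm_triangle_sub[of "F n u" "F n 0"] by simp
    qed
    show "\<exists>d>0. \<forall>n u'. u' \<in> {0..1} \<and> norm (u - u') < d \<longrightarrow> norm (F n u - F n u') < e"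
      if "u \<in> {0..1}" "0 < e" for u e
    proof (intro exI[of _ "e / B"] conjI allI impI)
      show "0 < e / B" using that B by simp
      fix n u' assume u': "u' \<in> {0..1} \<and> norm (u - u') < e / B"
      then have "B * \<bar>u - u'\<bar> < e" using B(1) by (simp add: field_simps)
      then show "norm (F n u - F n u') < e" using FB[OF that(1), of u' n] u' by linarith
    qed
  qed blast
  have lim: "(\<lambda>n. F (k n) u) \<longlonglongrightarrow> f u" if "u \<in> {0..1}" for u
    unfolding LIMSEQ_iff using f(2) that by blast
  have Lk: "(\<lambda>n. L (k n)) \<longlonglongrightarrow> C"
    using LIMSEQ_subseq_LIMSEQ[OF L f(1)] by (simp add: comp_def)
  have "C-lipschitz_on {0..1} f"
  proof (rule lipschitz_onI)
    show "0 \<le> C"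
      using lip by (intro LIMSEQ_le_const[OF L]) (auto dest: lipschitz_on_nonneg)
    fix u u' :: real assume u: "u \<in> {0..1}" "u' \<in> {0..1}"
    show "dist (f u) (f u') \<le> C * dist u u'"
    proof (rule LIMSEQ_le)
      show "(\<lambda>n. dist (F (k n) u) (F (k n) u')) \<longlonglongrightarrow> dist (f u) (f u')"
        by (intro tendsto_dist lim u)
      show "(\<lambda>n. L (k n) * dist u u') \<longlonglongrightarrow> C * dist u u'"
        by (intro tendsto_intros Lk)
    qed (use lipschitz_onD[OF lip u] in blast)
  qed
  then show thesis using that f(1) lim by blast
qed

text \<open>
  The error \<open>S j / (j + 1)\<close> allowed in the choice of almost shortest paths tends to \<open>0\<close> even after
  division by \<open>S j\<close>, so the limit path inherits exactly the constant \<open>l\<close>.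
\<close>

lemma lipschitz_path_in_tangent_cone:
  fixes X :: "'a::{real_normed_vector,heine_borel} set"
  assumes "p \<in> X" and unique: "has_unique_tangent_cone X p"
    and l: "l \<ge> 0" "\<And>x y. x \<in> X \<Longrightarrow> y \<in> X \<Longrightarrow> inner_dist X x y \<le> ennreal (l * norm (x - y))"
    and v: "v \<in> tangent_cone X p" and w: "w \<in> tangent_cone X p"
  obtains f :: "real \<Rightarrow> 'a" where "(l * norm (v - w))-lipschitz_on {0..1} f" "f ` {0..1} \<subseteq> tangent_cone X p"
    "f 0 = v" "f 1 = w"
proof -
  define S where "S j = 1 / real (Suc j)" for j
  have S: "\<And>j. S j > 0" "S \<longlonglongrightarrow> 0" unfolding S_def by (simp, real_asymp)
  obtain x where x: "\<And>j. x j \<in> X" "(\<lambda>j. (x j - p) /\<^sub>R S j) \<longlonglongrightarrow> v"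
    using tangent_cone_approximable[OF unique \<open>p \<in> X\<close> v S] by blast
  obtain y where y: "\<And>j. y j \<in> X" "(\<lambda>j. (y j - p) /\<^sub>R S j) \<longlonglongrightarrow> w"
    using tangent_cone_approximable[OF unique \<open>p \<in> X\<close> w S] by blast
  define M where "M j = l * norm (x j - y j) + S j / real (Suc j)" for j
  have M: "0 \<le> M j" "l * norm (x j - y j) < M j" for j
    using l(1) S(1)[of j] by (auto simp: M_def intro!: add_nonneg_nonneg)
  have "\<exists>c :: real \<Rightarrow> 'a. (M j)-lipschitz_on {0..1} c \<and> c ` {0..1} \<subseteq> X \<and> c 0 = x j \<and> c 1 = y j" for j
  proof -
    have "inner_dist X (x j) (y j) < ennreal (M j)"
      using l(2)[OF x(1) y(1)] M(2)[of j] l(1)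
      by (meson ennreal_lessI mult_nonneg_nonneg norm_ge_zero order_le_less_trans)
    then obtain g where g: "path g" "path_image g \<subseteq> X" "pathstart g = x j" "pathfinish g = y j"
      "path_length g < ennreal (M j)"
      unfolding inner_dist_def INF_less_iff by blast
    obtain c :: "real \<Rightarrow> 'a" where "(M j)-lipschitz_on {0..1} c" "c ` {0..1} \<subseteq> path_image g"
      "c 0 = x j" "c 1 = y j"
      using lipschitz_reparametrization[OF g(1) less_imp_le[OF g(5)] M(1)] g(3,4) by auto
    then show ?thesis using g(2) by (intro exI[of _ c]) auto
  qed
  then have "\<exists>c :: nat \<Rightarrow> real \<Rightarrow> 'a. \<forall>j. (M j)-lipschitz_on {0..1} (c j) \<and>
      c j ` {0..1} \<subseteq> X \<and> c j 0 = x j \<and> c j 1 = y j"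
    by (intro choice allI)
  then obtain c :: "nat \<Rightarrow> real \<Rightarrow> 'a" where c: "\<And>j. (M j)-lipschitz_on {0..1} (c j)" "\<And>j. c j ` {0..1} \<subseteq> X"
    "\<And>j. c j 0 = x j" "\<And>j. c j 1 = y j"
    by blast
  define F where "F j u = (c j u - p) /\<^sub>R S j" for j u
  have F_lip: "(M j / S j)-lipschitz_on {0..1} (F j)" for j
  proof (rule lipschitz_onI)
    fix a b :: real assume ab: "a \<in> {0..1}" "b \<in> {0..1}"
    have "dist (F j a) (F j b) = dist (c j a) (c j b) / S j"
      using S(1)[of j]
      by (simp add: F_def dist_norm divide_inverse flip: scaleR_diff_right)
    also have "\<dots> \<le> M j * dist a b / S j"
      using lipschitz_onD[OF c(1) ab] S(1)[of j] by (intro divide_right_mono) auto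
    finally show "dist (F j a) (F j b) \<le> M j / S j * dist a b" by simp
  qed (use M(1)[of j] S(1)[of j] in auto)
  have "norm ((x j - p) /\<^sub>R S j - (y j - p) /\<^sub>R S j) = norm (x j - y j) / S j" for j
    using S(1)[of j] by (simp add: divide_inverse flip: scaleR_diff_right)
  then have "M j / S j = l * norm ((x j - p) /\<^sub>R S j - (y j - p) /\<^sub>R S j) + 1 / real (Suc j)" for j
    using S(1)[of j]
    by (simp add: M_def add_divide_distrib)
  moreover have "(\<lambda>j. l * norm ((x j - p) /\<^sub>R S j - (y j - p) /\<^sub>R S j) + 1 / real (Suc j))
      \<longlonglongrightarrow> l * norm (v - w) + 0"
    using S(2) unfolding S_def[symmetric] by (intro tendsto_intros x(2) y(2))
  ultimately have M_lim: "(\<lambda>j. M j / S j) \<longlonglongrightarrow> l * norm (v - w)" by simp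
  have F0: "(\<lambda>j. F j 0) \<longlonglongrightarrow> v" and F1: "(\<lambda>j. F j 1) \<longlonglongrightarrow> w"
    using x(2) y(2) by (simp_all add: F_def c)
  obtain f k where f: "(l * norm (v - w))-lipschitz_on {0..1} f" and k: "strict_mono k"
    and lim: "\<And>u. u \<in> {0..1} \<Longrightarrow> (\<lambda>n. F (k n) u) \<longlonglongrightarrow> f u"
    using lipschitz_limit_subsequence[OF F_lip M_lim F0] by blast
  show thesis
  proof
    show "(l * norm (v - w))-lipschitz_on {0..1} f" by fact
    show "f 0 = v"
      using LIMSEQ_unique[OF lim LIMSEQ_subseq_LIMSEQ[OF F0 k, unfolded comp_def]] by simp
    show "f 1 = w"
      using LIMSEQ_unique[OF lim LIMSEQ_subseq_LIMSEQ[OF F1 k, unfolded comp_def]] by simp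
    show "f ` {0..1} \<subseteq> tangent_cone X p"
    proof clarify
      fix u :: real assume u: "u \<in> {0..1}"
      show "f u \<in> tangent_cone X p"
      proof (rule blowup_limit_in_tangent_cone[OF unique zero_in_tangent_cone[OF unique v]])
        show "c (k j) u \<in> X" for j using c(2) u by blast
        show "S (k j) > 0" for j by (rule S(1))
        show "(\<lambda>j. S (k j)) \<longlonglongrightarrow> 0"
          using LIMSEQ_subseq_LIMSEQ[OF S(2) k] by (simp add: comp_def)
        show "(\<lambda>j. (c (k j) u - p) /\<^sub>R S (k j)) \<longlonglongrightarrow> f u"
          using lim[OF u] by (simp add: F_def)
      qed
    qed
  qed
qed

theorem theorem2p6:
  fixes X :: "(real ^ 'm) set" and x0 :: "real ^ 'm"
  assumes "x0 \<in> X"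
    and "has_unique_tangent_cone X x0"
    and "lipschitz_normally_embedded X"
  shows "lipschitz_normally_embedded (tangent_cone X x0)"
proof -
  let ?T = "tangent_cone X x0"
  obtain l where l: "l \<ge> 1"
    "\<And>x y. x \<in> X \<Longrightarrow> y \<in> X \<Longrightarrow> inner_dist X x y \<le> ennreal (l * norm (x - y))"
    using assms(3) unfolding lipschitz_normally_embedded_def by blast
  have joined: "\<exists>f. path f \<and> path_image f \<subseteq> ?T \<and> pathstart f = v \<and> pathfinish f = w \<and>
      path_length f \<le> ennreal (l * norm (v - w))" if vw: "v \<in> ?T" "w \<in> ?T" for v w
  proof -
    have "l \<ge> 0" using l(1) by simp
    then obtain f :: "real \<Rightarrow> real ^ 'm"
      where f: "(l * norm (v - w))-lipschitz_on {0..1} f" "f ` {0..1} \<subseteq> ?T" "f 0 = v" "f 1 = w"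
      using lipschitz_path_in_tangent_cone[OF assms(1,2) _ l(2) vw] by blast
    show ?thesis
      using f path_length_le_lipschitz[OF f(1)] lipschitz_on_continuous_on[OF f(1)]
      by (intro exI[of _ f]) (auto simp: path_def path_image_def pathstart_def pathfinish_def)
  qed
  have "path_connected ?T"
    unfolding path_connected_def using joined by blast
  moreover have "inner_dist ?T v w \<le> ennreal (l * norm (v - w))" if "v \<in> ?T" "w \<in> ?T" for v w
    unfolding inner_dist_def using joined[OF that] by (auto intro: INF_lower2)
  ultimately show ?thesis
    unfolding lipschitz_normally_embedded_def using l(1) by blast
qed

end
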